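(* Let $$\Lambda^2=\bigcup_{n=1}^\infty\Big\{\big(x,\tfrac{x^2}{n}\big):x\in\mathbb{R}\Big\}\cup\bigcup_{n=1}^\infty\Big\{\big(x,-\tfrac{x^2}{n}\big):x\in\mathbb{R}\Big\}\subset\mathbb{R}^2 .$$ Then $\Lambda^2$ has property (iii) for $j=1$, and $\Lambda^2$ does not have weak locally finite $\mathcal{H}^1$ measure. Consequently property (iii) does not imply weak locally finite $\mathcal{H}^j$ measure.
   Context: Property (iii) (fine weak $j$-dimensional approximation property) for $A\subset\mathbb{R}^n$: for every $\delta>0$ and every $y\in A$ there is $\rho_y>0$ such that for all $\rho\in(0,\rho_y]$ there is a $j$-dimensional affine space $L_{y,\rho}$ containing $y$ with $B_\rho(y)\cap A\subset L_{y,\rho}^{\delta\rho}$, where $L^s:=\{x:|x-z|<s\text{ for some }z\in L\}$ and $B_\rho(y)$ is the open ball. A set $A$ has weak locally finite $\mathcal{H}^j$ measure ($\mathcal{H}^j$ being $j$-dimensional Hausdorff measure) if for each $y\in A$ there is $\rho_y>0$ with $\mathcal{H}^j(B_{\rho_y}(y)\cap A)<\infty$. *)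

theory Defs
  imports "HOL-Analysis.Analysis"
begin

text \<open>
  The \<open>j\<close>-dimensional Hausdorff measure, by Caratheodory's construction from countable covers by
  sets of small diameter. It has the usual normalisation \<open>\<omega>\<^sub>j (diam U / 2)\<^sup>j\<close>, where \<open>\<omega>\<^sub>j\<close> is the
  volume of the unit ball of \<open>\<real>\<^sup>j\<close>. The empty set gets weight 0, which matters only for \<open>j = 0\<close>,
  so that finite covers are included as sequences that are eventually empty.
  Boundedness of the covering sets is required separately because \<^term>\<open>diameter\<close> takes real
  values and is meaningless on unbounded sets.
\<close>

definition hausdorff_weight :: "nat \<Rightarrow> 'a::metric_space set \<Rightarrow> ennreal" where
  "hausdorff_weight j U =
     (if U = {} then 0 else ennreal (unit_ball_vol (real j) * (diameter U / 2) ^ j))"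

definition hausdorff_premeasure :: "nat \<Rightarrow> real \<Rightarrow> 'a::metric_space set \<Rightarrow> ennreal" where
  "hausdorff_premeasure j \<delta> A =
     (INF U \<in> {U :: nat \<Rightarrow> 'a set. A \<subseteq> (\<Union>i. U i) \<and> (\<forall>i. bounded (U i) \<and> diameter (U i) \<le> \<delta>)}.
        \<Sum>i. hausdorff_weight j (U i))"

definition hausdorff_measure :: "nat \<Rightarrow> 'a::metric_space set \<Rightarrow> ennreal" where
  "hausdorff_measure j A = (SUP \<delta> \<in> {0<..}. hausdorff_premeasure j \<delta> A)"

definition weak_locally_finite_hausdorff :: "nat \<Rightarrow> 'a::metric_space set \<Rightarrow> bool" where
  "weak_locally_finite_hausdorff j A \<longleftrightarrow>
     (\<forall>y\<in>A. \<exists>\<rho>>0. hausdorff_measure j (ball y \<rho> \<inter> A) < \<infinity>)"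

definition open_nbhd :: "'a::real_normed_vector set \<Rightarrow> real \<Rightarrow> 'a set" where
  "open_nbhd L s = {x. \<exists>z\<in>L. norm (x - z) < s}"

definition fine_weak_approximation :: "nat \<Rightarrow> 'a::euclidean_space set \<Rightarrow> bool" where
  "fine_weak_approximation j A \<longleftrightarrow>
     (\<forall>\<delta>>0. \<forall>y\<in>A. \<exists>\<rho>\<^sub>y>0. \<forall>\<rho>\<in>{0<..\<rho>\<^sub>y}.
        \<exists>L. affine L \<and> aff_dim L = int j \<and> y \<in> L \<and>
            ball y \<rho> \<inter> A \<subseteq> open_nbhd L (\<delta> * \<rho>))"

definition Lambda2 :: "(real ^ 2) set" where
  "Lambda2 =
     (\<Union>n\<in>{1::nat..}. {vector [x, x\<^sup>2 / real n] | x :: real. True}) \<union>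
     (\<Union>n\<in>{1::nat..}. {vector [x, - (x\<^sup>2 / real n)] | x :: real. True})"

end

theory Submission
  imports Defs
begin

text \<open>
  The nonzero points of \<open>\<Lambda>\<^sup>2\<close> satisfy \<open>x\<^sub>1\<^sup>2 / x\<^sub>2 \<in> \<int>\<close>, and this quotient is continuous off the axis, so
  it is constant on \<open>\<Lambda>\<^sup>2\<close> near such a point: there \<open>\<Lambda>\<^sup>2\<close> is a single parabola, approximated by its
  tangent. Near the origin the horizontal axis works because \<open>\<bar>x\<^sub>2\<bar> \<le> x\<^sub>1\<^sup>2\<close>.

  Every ball around the origin contains, for every \<open>N\<close>, arcs of \<open>N\<close> different parabolas over one
  interval \<open>[c, 2c)\<close>. At small scales \<open>x\<^sub>1 + c x\<^sub>1\<^sup>2 / x\<^sub>2\<close> is 1-Lipschitz on their union; it lays the arcs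
  side by side on an interval of length \<open>N c\<close>, so their \<open>\<H>\<^sup>1\<close> measure is at least \<open>N c\<close>.
\<close>

section \<open>Lower bounds for one-dimensional Hausdorff measure\<close>

lemma hausdorff_weight_1: "hausdorff_weight 1 U = ennreal (diameter U)"
  by (simp add: hausdorff_weight_def)

lemma hausdorff_premeasure_mono:
  assumes "A \<subseteq> B"
  shows "hausdorff_premeasure j \<delta> A \<le> hausdorff_premeasure j \<delta> B"
  unfolding hausdorff_premeasure_def using assms by (intro INF_superset_mono) auto

lemma hausdorff_measure_mono:
  assumes "A \<subseteq> B"
  shows "hausdorff_measure j A \<le> hausdorff_measure j B"
  unfolding hausdorff_measure_def
  by (intro SUP_mono) (use hausdorff_premeasure_mono[OF assms] in blast)

lemma hausdorff_premeasure_le_measure: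
  assumes "\<delta> > 0"
  shows "hausdorff_premeasure j \<delta> A \<le> hausdorff_measure j A"
  unfolding hausdorff_measure_def using assms by (intro SUP_upper) auto

text \<open>Every covering set has diameter at most \<open>\<delta>\<close>, so contraction at scale
  \<open>\<delta>\<close> is enough for its trace on \<open>S\<close> to have an image no longer
  than its diameter. Summing these lengths bounds the outer size of the whole image.\<close>

lemma emeasure_image_le_hausdorff_premeasure:
  fixes S :: "'a::metric_space set" and f :: "'a \<Rightarrow> real"
  assumes contr: "\<And>p q. p \<in> S \<Longrightarrow> q \<in> S \<Longrightarrow> dist p q \<le> \<delta> \<Longrightarrow> \<bar>f p - f q\<bar> \<le> dist p q"
  shows "emeasure lborel (f ` S) \<le> hausdorff_premeasure 1 \<delta> S"
  unfolding hausdorff_premeasure_def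
proof (rule INF_greatest, clarify)
  fix U :: "nat \<Rightarrow> 'a set"
  assume cover: "S \<subseteq> (\<Union>i. U i)" and small: "\<forall>i. bounded (U i) \<and> diameter (U i) \<le> \<delta>"
  \<comment> \<open>The image of a piece may fail to be Borel, so it is enclosed in a measurable
    set: the closed interval of length \<open>diameter (U i)\<close> starting at the infimum of the
    image.\<close>
  have "\<exists>I. I \<in> sets lborel \<and> f ` (S \<inter> U i) \<subseteq> I \<and> emeasure lborel I \<le> ennreal (diameter (U i))" for i
  proof (cases "S \<inter> U i = {}")
    case True
    then show ?thesis by (intro exI[of _ "{}"]) auto
  next
    case False
    let ?T = "f ` (S \<inter> U i)" and ?d = "diameter (U i)"
    have close: "\<bar>f p - f q\<bar> \<le> ?d" if "p \<in> S \<inter> U i" "q \<in> S \<inter> U i" for p q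
    proof -
      have "dist p q \<le> ?d"
        using that small by (intro diameter_bounded_bound) auto
      moreover from this small have "dist p q \<le> \<delta>"
        using order_trans by blast
      ultimately show ?thesis
        using contr[of p q] that by auto
    qed
    from False obtain p0 where p0: "p0 \<in> S \<inter> U i" by blast
    have bdd: "bdd_below ?T"
      by (rule bdd_belowI[of _ "f p0 - ?d"]) (use close[OF p0] in \<open>force simp: abs_le_iff\<close>)
    have "?T \<subseteq> {Inf ?T .. Inf ?T + ?d}"
    proof
      fix t assume t: "t \<in> ?T"
      have "t - ?d \<le> Inf ?T"
        by (rule cInf_greatest) (use False t close in \<open>force simp: abs_le_iff\<close>)+
      then show "t \<in> {Inf ?T .. Inf ?T + ?d}"
        using cInf_lower[OF t bdd] by auto
    qed
    moreover have "?d \<ge> 0"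
      using small by (intro diameter_ge_0) auto
    ultimately show ?thesis
      by (intro exI[of _ "{Inf ?T .. Inf ?T + ?d}"]) auto
  qed
  then obtain I where I: "\<And>i. I i \<in> sets lborel" "\<And>i. f ` (S \<inter> U i) \<subseteq> I i"
      "\<And>i. emeasure lborel (I i) \<le> ennreal (diameter (U i))"
    by metis
  have "f ` S \<subseteq> (\<Union>i. I i)"
    using cover I(2) by blast
  then have "emeasure lborel (f ` S) \<le> emeasure lborel (\<Union>i. I i)"
    using I(1) by (intro emeasure_mono) auto
  also have "\<dots> \<le> (\<Sum>i. emeasure lborel (I i))"
    using I(1) by (intro emeasure_subadditive_countably) auto
  also have "\<dots> \<le> (\<Sum>i. hausdorff_weight 1 (U i))"
    unfolding hausdorff_weight_1 by (intro suminf_le I(3)) auto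
  finally show "emeasure lborel (f ` S) \<le> (\<Sum>i. hausdorff_weight 1 (U i))" .
qed

section \<open>Membership in \<open>Lambda2\<close> and approximation by tangent lines\<close>

lemma mem_Lambda2_iff:
  "p \<in> Lambda2 \<longleftrightarrow> (\<exists>k::int. k \<noteq> 0 \<and> p $ 2 = (p $ 1)\<^sup>2 / of_int k)"
proof
  assume "p \<in> Lambda2"
  then obtain n :: nat and x :: real where n: "n \<ge> 1"
    and "p = vector [x, x\<^sup>2 / real n] \<or> p = vector [x, - (x\<^sup>2 / real n)]"
    unfolding Lambda2_def by auto
  then show "\<exists>k::int. k \<noteq> 0 \<and> p $ 2 = (p $ 1)\<^sup>2 / of_int k"
  proof (elim disjE)
    assume "p = vector [x, x\<^sup>2 / real n]"
    then show ?thesis using n by (intro exI[of _ "int n"]) auto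
  next
    assume "p = vector [x, - (x\<^sup>2 / real n)]"
    then show ?thesis using n by (intro exI[of _ "- int n"]) auto
  qed
next
  assume "\<exists>k::int. k \<noteq> 0 \<and> p $ 2 = (p $ 1)\<^sup>2 / of_int k"
  then obtain k :: int where k: "k \<noteq> 0" "p $ 2 = (p $ 1)\<^sup>2 / of_int k" by blast
  have p: "p = vector [p $ 1, p $ 2]"
    by (simp add: vec_eq_iff forall_2)
  show "p \<in> Lambda2"
  \<comment> \<open>The sign of \<open>k\<close> selects the family: positive for the parabolas
    opening upwards, negative for those opening downwards.\<close>
  proof (cases "k > 0")
    case True
    then have "p = vector [p $ 1, (p $ 1)\<^sup>2 / real (nat k)]" "nat k \<ge> 1"
      using p k by auto
    then show ?thesis unfolding Lambda2_def by blast
  next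
    case False
    then have "p = vector [p $ 1, - ((p $ 1)\<^sup>2 / real (nat (- k)))]" "nat (- k) \<ge> 1"
      using p k by auto
    then show ?thesis unfolding Lambda2_def by blast
  qed
qed

lemma square_div_int_bound:
  fixes t :: real
  assumes "k \<noteq> 0"
  shows "\<bar>t\<^sup>2 / of_int k\<bar> \<le> t\<^sup>2"
proof -
  have "1 \<le> \<bar>real_of_int k\<bar>"
    using assms by linarith
  then have "t\<^sup>2 * 1 \<le> t\<^sup>2 * \<bar>real_of_int k\<bar>"
    by (intro mult_left_mono) auto
  then show ?thesis
    using assms by (simp add: abs_divide pos_divide_le_eq)
qed

text \<open>Take the line of slope \<open>m\<close> through \<open>y\<close>. A quadratic error is
  below \<open>\<rho>\<^sup>2\<close>, hence below \<open>\<delta> * \<rho>\<close> as soon as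
  \<open>\<rho> \<le> \<delta>\<close>; this explains the threshold
  \<open>min r \<delta>\<close>.\<close>

lemma fine_weak_approximation_tangent_lines:
  fixes A :: "(real ^ 2) set"
  assumes "\<And>y. y \<in> A \<Longrightarrow> \<exists>r>0. \<exists>m. \<forall>p \<in> ball y r \<inter> A.
             \<bar>p $ 2 - y $ 2 - m * (p $ 1 - y $ 1)\<bar> \<le> (p $ 1 - y $ 1)\<^sup>2"
  shows "fine_weak_approximation 1 A"
  unfolding fine_weak_approximation_def
proof (intro allI impI ballI)
  fix \<delta> :: real and y assume "\<delta> > 0" "y \<in> A"
  from assms[OF \<open>y \<in> A\<close>] obtain r m where r: "r > 0"
    and m: "\<And>p. p \<in> ball y r \<inter> A \<Longrightarrow> \<bar>p $ 2 - y $ 2 - m * (p $ 1 - y $ 1)\<bar> \<le> (p $ 1 - y $ 1)\<^sup>2"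
    by blast
  define v :: "real ^ 2" where "v = vector [1, m]"
  have v: "v $ 1 = 1" "v $ 2 = m" by (simp_all add: v_def)
  define L where "L = affine hull {y, y + v}"
  have "v \<noteq> 0"
    using v by (metis zero_index zero_neq_one)
  then have L: "affine L" "aff_dim L = int 1" "y \<in> L"
    by (auto simp: L_def aff_dim_2 hull_inc)
  have "ball y \<rho> \<inter> A \<subseteq> open_nbhd L (\<delta> * \<rho>)" if \<rho>: "\<rho> \<in> {0<..min r \<delta>}" for \<rho>
  proof
    fix p assume p: "p \<in> ball y \<rho> \<inter> A"
    let ?t = "p $ 1 - y $ 1"
    let ?z = "y + ?t *\<^sub>R v"
    have "?z \<in> L"
      unfolding L_def affine_hull_2_alt by auto
    have "\<bar>?t\<bar> \<le> norm (p - y)"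
      using component_le_norm_cart[of "p - y" 1] by simp
    also have "\<dots> < \<rho>"
      using p by (simp add: dist_norm norm_minus_commute)
    finally have t: "\<bar>?t\<bar> < \<rho>" .
    \<comment> \<open>The point \<open>?z\<close> of \<open>L\<close> lies vertically above or below
      \<open>p\<close>, so only the second coordinate contributes to the distance.\<close>
    have "norm (p - ?z) \<le> \<bar>(p - ?z) $ 1\<bar> + \<bar>(p - ?z) $ 2\<bar>"
      using norm_le_l1_cart[of "p - ?z"] by (simp add: sum_2)
    also have "\<dots> = \<bar>p $ 2 - y $ 2 - m * ?t\<bar>"
      by (simp add: v algebra_simps)
    also have "\<dots> \<le> ?t\<^sup>2"
      using p \<rho> by (intro m) auto
    also have "\<dots> < \<rho>\<^sup>2"
      using power_strict_mono[OF t, of 2] by simp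
    also have "\<dots> \<le> \<delta> * \<rho>"
      using \<rho> by (simp add: power2_eq_square)
    finally show "p \<in> open_nbhd L (\<delta> * \<rho>)"
      using \<open>?z \<in> L\<close> unfolding open_nbhd_def by blast
  qed
  moreover have "min r \<delta> > 0"
    using r \<open>\<delta> > 0\<close> by simp
  ultimately show "\<exists>\<rho>\<^sub>y>0. \<forall>\<rho>\<in>{0<..\<rho>\<^sub>y}. \<exists>L. affine L \<and> aff_dim L = int 1 \<and> y \<in> L \<and>
      ball y \<rho> \<inter> A \<subseteq> open_nbhd L (\<delta> * \<rho>)"
    using L by blast
qed

lemma Lambda2_locally_parabola:
  assumes "y $ 2 = (y $ 1)\<^sup>2 / of_int k" "y $ 2 \<noteq> 0"
  shows "\<exists>r>0. \<forall>p \<in> ball y r \<inter> Lambda2. p $ 2 = (p $ 1)\<^sup>2 / of_int k"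
proof -
  have k: "(y $ 1)\<^sup>2 / y $ 2 = of_int k"
    using assms by auto
  have lim: "((\<lambda>p. (p $ 1)\<^sup>2 / p $ 2) \<longlongrightarrow> of_int k) (at y)" "((\<lambda>p. p $ 2) \<longlongrightarrow> y $ 2) (at y)"
    unfolding k[symmetric] by (intro tendsto_intros assms(2))+
  \<comment> \<open>Distance below 1 between two integers forces equality. Keeping
    \<open>p $ 2\<close> nonzero makes the quotient the true parameter of the parabola through
    \<open>p\<close>, not the default value of a division by zero.\<close>
  have "\<forall>\<^sub>F p in at y. dist ((p $ 1)\<^sup>2 / p $ 2) (of_int k) < 1 \<and> p $ 2 \<noteq> 0"
    using tendstoD[OF lim(1), of 1] tendsto_imp_eventually_ne[OF lim(2) assms(2)]
    by (simp add: eventually_conj)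
  then obtain r where r: "r > 0" and near: "\<And>p. p \<noteq> y \<Longrightarrow> dist p y < r \<Longrightarrow>
      dist ((p $ 1)\<^sup>2 / p $ 2) (of_int k) < 1 \<and> p $ 2 \<noteq> 0"
    unfolding eventually_at by auto
  have "p $ 2 = (p $ 1)\<^sup>2 / of_int k" if p: "p \<in> ball y r \<inter> Lambda2" for p
  proof (cases "p = y")
    case False
    then have *: "dist ((p $ 1)\<^sup>2 / p $ 2) (of_int k) < 1" "p $ 2 \<noteq> 0"
      using near[of p] p by (auto simp: dist_commute)
    from p obtain l :: int where l: "p $ 2 = (p $ 1)\<^sup>2 / of_int l"
      by (auto simp: mem_Lambda2_iff)
    with *(2) have "(p $ 1)\<^sup>2 / p $ 2 = of_int l"
      by auto
    with *(1) have "\<bar>real_of_int (l - k)\<bar> < 1"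
      by (simp add: dist_real_def)
    then have "l = k" by linarith
    with l show ?thesis by simp
  qed (use assms in simp)
  with r show ?thesis by blast
qed

lemma fine_weak_approximation_Lambda2: "fine_weak_approximation 1 Lambda2"
proof (rule fine_weak_approximation_tangent_lines)
  fix y assume "y \<in> Lambda2"
  then obtain k :: int where k: "k \<noteq> 0" "y $ 2 = (y $ 1)\<^sup>2 / of_int k"
    by (auto simp: mem_Lambda2_iff)
  show "\<exists>r>0. \<exists>m. \<forall>p \<in> ball y r \<inter> Lambda2.
           \<bar>p $ 2 - y $ 2 - m * (p $ 1 - y $ 1)\<bar> \<le> (p $ 1 - y $ 1)\<^sup>2"
  proof (cases "y $ 2 = 0")
    case True
    then have "y $ 1 = 0" using k by simp
    \<comment> \<open>Here \<open>y\<close> is the origin, where all the parabolas are tangent to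
      the horizontal axis; the bound holds on all of \<open>Lambda2\<close>, so any radius will
      do.\<close>
    then have "\<bar>p $ 2 - y $ 2 - 0 * (p $ 1 - y $ 1)\<bar> \<le> (p $ 1 - y $ 1)\<^sup>2" if "p \<in> Lambda2" for p
      using that True square_div_int_bound[where t = "p $ 1"] by (auto simp: mem_Lambda2_iff)
    then show ?thesis
      by (intro exI[of _ 1] conjI exI[of _ 0]) auto
  next
    case False
    obtain r where r: "r > 0" "\<And>p. p \<in> ball y r \<inter> Lambda2 \<Longrightarrow> p $ 2 = (p $ 1)\<^sup>2 / of_int k"
      using Lambda2_locally_parabola[OF k(2) False] by blast
    \<comment> \<open>The slope is the derivative of the parabola at \<open>y $ 1\<close>, and the
      remainder of the quadratic is exactly its second-order term.\<close>
    have "\<bar>p $ 2 - y $ 2 - 2 * y $ 1 / of_int k * (p $ 1 - y $ 1)\<bar> \<le> (p $ 1 - y $ 1)\<^sup>2"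
      if "p \<in> ball y r \<inter> Lambda2" for p
    proof -
      have "p $ 2 - y $ 2 - 2 * y $ 1 / of_int k * (p $ 1 - y $ 1) = (p $ 1 - y $ 1)\<^sup>2 / of_int k"
        unfolding r(2)[OF that] k(2) using k(1) by (simp add: field_simps power2_eq_square)
      then show ?thesis
        using square_div_int_bound[OF k(1)] by simp
    qed
    with r(1) show ?thesis by blast
  qed
qed

section \<open>Separation of the arcs and infinite measure near the origin\<close>

lemma parabolas_separated:
  fixes x y c d N :: real and k l :: nat
  assumes "k \<noteq> l" "k \<ge> 1" "l \<ge> 1" "real k \<le> N" "real l \<le> N"
    and "c > 0" "x \<in> {c..<2*c}" "y \<in> {c..<2*c}"
    and "\<bar>x - y\<bar> \<le> d" "\<bar>x\<^sup>2 / real k - y\<^sup>2 / real l\<bar> \<le> d"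
  shows "c\<^sup>2 \<le> d * (N\<^sup>2 + 4 * c * N)"
  using assms
\<comment> \<open>The hypotheses are symmetric under exchanging \<open>(k, x)\<close> with
  \<open>(l, y)\<close>, so \<open>k < l\<close> may be assumed, and then \<open>l - k\<close> is at
  least 1.\<close>
proof (induction k l arbitrary: x y rule: linorder_wlog)
  case (le k l)
  have d: "d \<ge> 0" using le.prems(9) by linarith
  have "c\<^sup>2 \<le> x\<^sup>2"
    using le.prems by (intro power_mono) auto
  also have "\<dots> \<le> x\<^sup>2 * (real l - real k)"
    using le by (intro mult_left_mono[of 1 _ "x\<^sup>2", simplified]) auto
  \<comment> \<open>Split \<open>l x^2 - k x^2\<close> as
    \<open>(l x^2 - k y^2) + k (y^2 - x^2)\<close>: the first bracket is \<open>k l\<close> times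
    the vertical gap, the second is the horizontal gap times \<open>x + y\<close>, which is below
    \<open>4 * c\<close>.\<close>
  also have "\<dots> = real k * real l * (x\<^sup>2 / real k - y\<^sup>2 / real l) + real k * ((y - x) * (x + y))"
    using le.prems(2,3) by (simp add: field_simps power2_eq_square)
  also have "\<dots> \<le> N * N * d + N * (d * (4 * c))"
  proof (intro add_mono)
    have "real k * real l * (x\<^sup>2 / real k - y\<^sup>2 / real l) \<le> real k * real l * d"
      using le.prems(10) by (intro mult_left_mono) auto
    also have "\<dots> \<le> N * N * d"
      using le.prems d by (intro mult_right_mono mult_mono) auto
    finally show "real k * real l * (x\<^sup>2 / real k - y\<^sup>2 / real l) \<le> N * N * d" .
    have "(y - x) * (x + y) \<le> d * (4 * c)"
      using le.prems d by (intro mult_mono) auto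
    then have "real k * ((y - x) * (x + y)) \<le> real k * (d * (4 * c))"
      by (intro mult_left_mono) auto
    also have "\<dots> \<le> N * (d * (4 * c))"
      using le.prems d by (intro mult_right_mono) auto
    finally show "real k * ((y - x) * (x + y)) \<le> N * (d * (4 * c))" .
  qed
  finally show ?case by (simp add: algebra_simps power2_eq_square)
next
  case (sym l k)
  show ?case
    by (rule sym.IH[of y x]) (use sym.prems in \<open>auto simp: abs_minus_commute\<close>)
qed

text \<open>On the arc with parameter \<open>k\<close> the map \<open>f\<close> is the first
  coordinate shifted by \<open>c * k\<close>, with image \<open>[(k+1)c, (k+2)c)\<close>. For
  \<open>k\<close> from 1 to \<open>N\<close> these intervals tile
  \<open>[2c, (N+2)c)\<close>.\<close>

lemma hausdorff_measure_parabola_arcs_ge: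
  fixes c :: real and N :: nat
  assumes c: "c > 0"
  shows "ennreal (real N * c) \<le> hausdorff_measure 1
           {p :: real ^ 2. p $ 1 \<in> {c..<2*c} \<and> (\<exists>k\<in>{1..N}. p $ 2 = (p $ 1)\<^sup>2 / real k)}"
    (is "_ \<le> hausdorff_measure 1 ?S")
proof -
  define f :: "real ^ 2 \<Rightarrow> real" where "f = (\<lambda>p. p $ 1 + c * ((p $ 1)\<^sup>2 / p $ 2))"
  have f: "f p = p $ 1 + c * real k" if "p $ 1 \<ge> c" "k \<ge> 1" "p $ 2 = (p $ 1)\<^sup>2 / real k" for p k
    using that c by (auto simp: f_def)
  \<comment> \<open>\<open>M\<close> is the factor from \<open>parabolas_separated\<close> plus 1,
    positive even for \<open>N = 0\<close>. The 2 in \<open>\<delta>\<close> makes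
    \<open>\<delta> * M\<close> equal \<open>c\<^sup>2 / 2\<close>, so points within
    \<open>\<delta>\<close> of each other cannot lie on different arcs.\<close>
  define M where "M = (real N)\<^sup>2 + 4 * c * real N + 1"
  define \<delta> where "\<delta> = c\<^sup>2 / (2 * M)"
  have M: "M > 0" using c by (simp add: M_def add_nonneg_pos)
  have \<delta>: "\<delta> > 0" using c M by (simp add: \<delta>_def)
  have "emeasure lborel (f ` ?S) \<le> hausdorff_premeasure 1 \<delta> ?S"
  proof (rule emeasure_image_le_hausdorff_premeasure)
    fix p q assume "p \<in> ?S" "q \<in> ?S" and pq: "dist p q \<le> \<delta>"
    then obtain k l where k: "k \<ge> 1" "k \<le> N" "p $ 2 = (p $ 1)\<^sup>2 / real k"
      and l: "l \<ge> 1" "l \<le> N" "q $ 2 = (q $ 1)\<^sup>2 / real l"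
      and x: "p $ 1 \<in> {c..<2*c}" "q $ 1 \<in> {c..<2*c}" by auto
    have comp: "\<bar>p $ i - q $ i\<bar> \<le> dist p q" for i
      using component_le_norm_cart[of "p - q" i] by (simp add: dist_norm)
    have "k = l"
    proof (rule ccontr)
      assume "k \<noteq> l"
      then have "c\<^sup>2 \<le> \<delta> * ((real N)\<^sup>2 + 4 * c * real N)"
        using k l x c order_trans[OF comp[of 1] pq] order_trans[OF comp[of 2] pq]
        by (intro parabolas_separated[of k l _ _ "p $ 1" "q $ 1"]) auto
      also have "\<dots> \<le> \<delta> * M"
        using \<delta> by (intro mult_left_mono) (auto simp: M_def)
      also have "\<dots> = c\<^sup>2 / 2"
        using M by (simp add: \<delta>_def)
      finally show False using c by simp
    qed
    then have "\<bar>f p - f q\<bar> = \<bar>p $ 1 - q $ 1\<bar>"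
      using f[of p k] f[of q l] k l x by simp
    with comp[of 1] show "\<bar>f p - f q\<bar> \<le> dist p q" by simp
  qed
  also have "\<dots> \<le> hausdorff_measure 1 ?S"
    by (rule hausdorff_premeasure_le_measure[OF \<delta>])
  finally have le: "emeasure lborel (f ` ?S) \<le> hausdorff_measure 1 ?S" .
  have "f ` ?S = {2 * c..<(real N + 2) * c}"
  proof (intro equalityI subsetI)
    fix t assume "t \<in> f ` ?S"
    then obtain p k where k: "k \<ge> 1" "k \<le> N" "p $ 2 = (p $ 1)\<^sup>2 / real k"
      and x: "p $ 1 \<in> {c..<2*c}" and t: "t = f p" by auto
    have "c * 1 \<le> c * real k" "c * real k \<le> c * real N"
      using c k by (intro mult_left_mono; simp)+
    moreover have "f p = p $ 1 + c * real k"
      using f k x by simp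
    moreover have "(real N + 2) * c = c * real N + 2 * c"
      by (simp add: algebra_simps)
    ultimately have "2 * c \<le> f p" "f p < (real N + 2) * c"
      using x unfolding atLeastLessThan_iff by linarith+
    then show "t \<in> {2 * c..<(real N + 2) * c}"
      by (simp add: t)
  next
    fix t assume t: "t \<in> {2 * c..<(real N + 2) * c}"
    \<comment> \<open>A value \<open>t\<close> in \<open>[(k+1)c, (k+2)c)\<close> has
      \<open>\<lfloor>t / c\<rfloor> = k + 1\<close>; since \<open>t / c\<close> is at least 2, the
      natural subtraction does not truncate.\<close>
    define k where "k = nat \<lfloor>t / c\<rfloor> - 1"
    define x where "x = t - c * real k"
    have "2 \<le> t / c" "t / c < real N + 2"
      using t c by (auto simp: field_simps)
    then have k: "1 \<le> k" "k \<le> N" "real k + 1 \<le> t / c" "t / c < real k + 2"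
      unfolding k_def by linarith+
    then have x: "x \<in> {c..<2*c}"
      using c by (auto simp: x_def field_simps)
    define p :: "real ^ 2" where "p = vector [x, x\<^sup>2 / real k]"
    have p: "p $ 1 = x" "p $ 2 = x\<^sup>2 / real k" by (simp_all add: p_def)
    have "p \<in> ?S" using p x k by auto
    moreover have "f p = t"
      using f[of p k] p x k by (simp add: x_def)
    ultimately show "t \<in> f ` ?S" by blast
  qed
  moreover have "2 * c \<le> (real N + 2) * c" using c by simp
  ultimately have "emeasure lborel (f ` ?S) = ennreal (real N * c)"
    by (simp add: algebra_simps)
  with le show ?thesis by simp
qed

lemma not_weak_locally_finite_hausdorff_Lambda2:
  "\<not> weak_locally_finite_hausdorff 1 Lambda2"
proof
  assume "weak_locally_finite_hausdorff 1 Lambda2"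
  moreover have "(0 :: real ^ 2) \<in> Lambda2"
    by (auto simp: mem_Lambda2_iff intro: exI[of _ 1])
  ultimately obtain \<rho> where \<rho>: "\<rho> > 0" and fin: "hausdorff_measure 1 (ball 0 \<rho> \<inter> Lambda2) < \<infinity>"
    unfolding weak_locally_finite_hausdorff_def by blast
  \<comment> \<open>One \<open>c\<close> serves every \<open>N\<close>. The bound by 1 gives
    \<open>\<bar>p $ 2\<bar> \<le> p $ 1\<close> on the arcs, and the 4 gives
    \<open>\<bar>p $ 1\<bar> + \<bar>p $ 2\<bar> < 4 * c \<le> \<rho>\<close>, so all arcs lie in
    the ball.\<close>
  define c where "c = min \<rho> 1 / 4"
  have c: "c > 0" "4 * c \<le> \<rho>" "4 * c \<le> 1" using \<rho> by (auto simp: c_def)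
  have large: "ennreal (real N * c) \<le> hausdorff_measure 1 (ball 0 \<rho> \<inter> Lambda2)" for N
  proof (rule order_trans[OF hausdorff_measure_parabola_arcs_ge[OF c(1)] hausdorff_measure_mono])
    show "{p. p $ 1 \<in> {c..<2*c} \<and> (\<exists>k\<in>{1..N}. p $ 2 = (p $ 1)\<^sup>2 / real k)} \<subseteq> ball 0 \<rho> \<inter> Lambda2"
    proof clarify
      fix p :: "real ^ 2" and k
      assume x: "p $ 1 \<in> {c..<2*c}" and k: "k \<in> {1..N}" and p: "p $ 2 = (p $ 1)\<^sup>2 / real k"
      have p': "int k \<noteq> 0" "p $ 2 = (p $ 1)\<^sup>2 / of_int (int k)"
        using k p by auto
      have "\<bar>p $ 2\<bar> \<le> (p $ 1)\<^sup>2"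
        unfolding p'(2) by (rule square_div_int_bound[OF p'(1)])
      also have "\<dots> \<le> p $ 1 * 1"
        unfolding power2_eq_square using x c by (intro mult_left_mono) auto
      finally have "\<bar>p $ 1\<bar> + \<bar>p $ 2\<bar> < \<rho>"
        using x c by auto
      moreover have "norm p \<le> \<bar>p $ 1\<bar> + \<bar>p $ 2\<bar>"
        using norm_le_l1_cart[of p] by (simp add: sum_2)
      ultimately have "p \<in> ball 0 \<rho>" by simp
      moreover have "p \<in> Lambda2"
        unfolding mem_Lambda2_iff using p' by blast
      ultimately show "p \<in> ball 0 \<rho> \<inter> Lambda2" by blast
    qed
  qed
  from fin obtain r where r: "r \<ge> 0" "hausdorff_measure 1 (ball 0 \<rho> \<inter> Lambda2) = ennreal r"
    by (metis ennreal_cases infinity_ennreal_def less_irrefl)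
  obtain N :: nat where "r < real N * c"
    using reals_Archimedean3[OF c(1)] by blast
  with large[of N] r show False
    by (simp add: ennreal_le_iff)
qed

theorem proposition5p2:
  shows "fine_weak_approximation 1 Lambda2
       \<and> \<not> weak_locally_finite_hausdorff 1 Lambda2
       \<and> \<not> (\<forall>A :: (real ^ 2) set.
              fine_weak_approximation 1 A \<longrightarrow> weak_locally_finite_hausdorff 1 A)"
  using fine_weak_approximation_Lambda2 not_weak_locally_finite_hausdorff_Lambda2 by blast

end
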